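(* For every infinitely-ended LC-group $G$, the space of ends $\mathcal{E}^\star(G)$ has no isolated point.
   Context: An LC-group is a locally compact (Hausdorff) topological group. For an LC-group $G$, a subset $X\subset G$ is topologically left-commensurated if $KX\smallsetminus X$ has compact closure for every compact subset $K\subset G$. These subsets form a Boolean subalgebra $\mathcal{P}_{(G)}(G)$ of the power set of $G$, containing the ideal of subsets with compact closure; $\mathcal{P}^\star_G(G)$ denotes the quotient of $\mathcal{P}_{(G)}(G)$ by this ideal. The space of ends $\mathcal{E}^\star(G)$ is the Stone dual of $\mathcal{P}^\star_G(G)$, i.e. the compact Hausdorff totally disconnected space whose Boolean algebra of clopen subsets is $\mathcal{P}^\star_G(G)$. $G$ is infinitely-ended if $\mathcal{P}^\star_G(G)$ is infinite. *)

theory Defs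
  imports "HOL-Analysis.Analysis" "HOL-Algebra.Coset"
begin

locale lc_group = group G for G (structure) +
  fixes T :: "'a topology"
  assumes topspace_eq: "topspace T = carrier G"
    and continuous_mult: "continuous_map (prod_topology T T) T (\<lambda>(x, y). x \<otimes> y)"
    and continuous_inv: "continuous_map T T (\<lambda>x. inv x)"
    and locally_compact: "locally_compact_space T"
    and Hausdorff: "Hausdorff_space T"

text \<open>
  \<open>closure_of\<close> ignores points outside the space, so this is only meaningful
  for \<open>S \<subseteq> topspace T\<close>.
\<close>

definition has_compact_closure :: "'a topology \<Rightarrow> 'a set \<Rightarrow> bool" where
  "has_compact_closure T S \<longleftrightarrow> compactin T (T closure_of S)"

definition left_commensurated :: "('a, 'm) monoid_scheme \<Rightarrow> 'a topology \<Rightarrow> 'a set set" where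
  "left_commensurated G T =
     {X. X \<subseteq> carrier G \<and>
         (\<forall>K. compactin T K \<longrightarrow> has_compact_closure T ((K <#>\<^bsub>G\<^esub> X) - X))}"

text \<open>
  The quotient of the Boolean algebra of topologically left-commensurated subsets by the ideal of
  subsets with compact closure. Its elements are the classes of the relation
  ``the symmetric difference lies in the ideal'', and it is recorded as an ordered set: the
  class of \<open>X\<close> is below the class of \<open>Y\<close> iff \<open>X - Y\<close> lies in the ideal (which does not depend on
  the representatives). The order determines the Boolean operations.
\<close>

definition ends_rel :: "('a, 'm) monoid_scheme \<Rightarrow> 'a topology \<Rightarrow> ('a set \<times> 'a set) set" where
  "ends_rel G T =
     {(X, Y). X \<in> left_commensurated G T \<and> Y \<in> left_commensurated G T \<and>
              has_compact_closure T ((X - Y) \<union> (Y - X))}"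

definition ends_algebra :: "('a, 'm) monoid_scheme \<Rightarrow> 'a topology \<Rightarrow> 'a set set gorder" where
  "ends_algebra G T =
     \<lparr>carrier = left_commensurated G T // ends_rel G T,
      eq = (=),
      le = (\<lambda>A B. \<exists>X\<in>A. \<exists>Y\<in>B. has_compact_closure T (X - Y))\<rparr>"

definition infinitely_ended :: "('a, 'm) monoid_scheme \<Rightarrow> 'a topology \<Rightarrow> bool" where
  "infinitely_ended G T \<longleftrightarrow> infinite (carrier (ends_algebra G T))"

text \<open>
  The Stone dual of a Boolean algebra \<open>L\<close>, realised as the space of its ultrafilters, i.e. of
  its maximal proper filters, with the sets \<open>{F. a \<in> F}\<close> as a basis of the topology.
\<close>

definition proper_filter :: "('b, 'm) gorder_scheme \<Rightarrow> 'b set \<Rightarrow> bool" where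
  "proper_filter L F \<longleftrightarrow>
     F \<subseteq> carrier L \<and> F \<noteq> {} \<and> F \<noteq> carrier L \<and>
     (\<forall>a\<in>F. \<forall>b\<in>carrier L. a \<sqsubseteq>\<^bsub>L\<^esub> b \<longrightarrow> b \<in> F) \<and>
     (\<forall>a\<in>F. \<forall>b\<in>F. \<exists>c\<in>F. c \<sqsubseteq>\<^bsub>L\<^esub> a \<and> c \<sqsubseteq>\<^bsub>L\<^esub> b)"

definition ultrafilters :: "('b, 'm) gorder_scheme \<Rightarrow> 'b set set" where
  "ultrafilters L =
     {F. proper_filter L F \<and> (\<forall>F'. proper_filter L F' \<and> F \<subseteq> F' \<longrightarrow> F' = F)}"

definition stone_space :: "('b, 'm) gorder_scheme \<Rightarrow> 'b set topology" where
  "stone_space L =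
     topology_generated_by ((\<lambda>a. {F \<in> ultrafilters L. a \<in> F}) ` carrier L)"

definition ends_space :: "('a, 'm) monoid_scheme \<Rightarrow> 'a topology \<Rightarrow> 'a set set set topology" where
  "ends_space G T = stone_space (ends_algebra G T)"

end

theory Submission
  imports Defs "HOL-Algebra.Generated_Groups"
begin

text \<open>
  Write \<open>\<E>\<close> for the Boolean algebra of topologically left-commensurated subsets modulo those with
  compact closure (``bounded'' subsets, in the comments below). By Stone duality an isolated end is an
  atom of \<open>\<E>\<close>: an unbounded commensurated set \<open>X\<close> which is not the disjoint union of two
  unbounded commensurated sets (\<open>isolated_end_imp_atom\<close>). If the complement of \<open>X\<close> cannot be cut
  into two unbounded commensurated pieces either, then \<open>\<E>\<close> has at most four elements
  (\<open>ends_algebra_finite_if_unsplittable\<close>). So in an infinitely-ended group an atom \<open>X\<close> comes with a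
  partition \<open>G = X \<union> U \<union> V\<close> into three unbounded commensurated sets, and the whole content is the
  lemma \<open>commensurated_split\<close>: in that situation \<open>X\<close> is not an atom.

  The tool is right translation. Commensuration is a condition on left translates, so \<open>A g\<close> is
  commensurated whenever \<open>A\<close> is; hence each set \<open>X \<inter> A g\<close> is a candidate for cutting \<open>X\<close>. Two cases
  are distinguished, according to whether \<open>X\<close> is unbounded inside some compactly generated open subgroup.

  \<^emph>\<open>Yes.\<close> After enlarging it, a compactly generated subgroup \<open>H = \<langle>K\<rangle>\<close> meets all three of \<open>X\<close>, \<open>U\<close>,
  \<open>V\<close> in unbounded sets (\<open>ex_generate_meets_unbounded\<close>). This is the classical picture of a graph with
  three ends: a ball \<open>B = K\<^sup>n\<close> contains the boundaries of the three sets inside the Cayley graph of \<open>H\<close>.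
  Take \<open>h \<in> X \<inter> H\<close> so far out that \<open>B h\<close> is disjoint from \<open>B\<close>. Of the three pieces \<open>X h\<close>, \<open>U h\<close>,
  \<open>V h\<close> that \<open>B h\<close> separates, only one contains the connected set \<open>B\<close>; the other two lie, within \<open>H\<close>,
  entirely on the side \<open>X\<close> of \<open>B\<close> (\<open>corner_in_compactly_generated\<close>), so they cut \<open>X\<close> into two unbounded
  parts.

  \<^emph>\<open>No.\<close> Build an increasing sequence of compact sets \<open>S\<^sub>n\<close> whose union \<open>M\<close> is an open subgroup,
  such that \<open>S\<^sub>n\<^sub>+\<^sub>1\<close> contains the boundary of \<open>X\<close> with respect to \<open>S\<^sub>n\<close> and such that both \<open>X\<close> and its
  complement are unbounded in \<open>M\<close>. If \<open>M \<noteq> G\<close>, then \<open>X\<close> contains a whole coset \<open>M p\<close>, and \<open>X p\<close>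
  cuts it, hence cuts \<open>X\<close>. If \<open>M = G\<close>, then \<open>G\<close> is the increasing union of the subgroups
  \<open>H\<^sub>n = \<langle>S\<^sub>n\<rangle>\<close>, each of which contains only a bounded part of \<open>X\<close>; the elements of
  \<open>X\<close> in the differences \<open>H\<^sub>n\<^sub>+\<^sub>1 - H\<^sub>n\<close> with \<open>n\<close> even then form a commensurated set, and so does
  the rest of \<open>X\<close>. Both are unbounded because the construction makes every difference meet \<open>X\<close>
  (\<open>split_without_compactly_generated\<close>).
\<close>

section \<open>Compactness in locally compact groups\<close>

context lc_group
begin

abbreviation rel_compact :: "'a set \<Rightarrow> bool" where
  "rel_compact S \<equiv> has_compact_closure T S"

abbreviation commensurated :: "'a set \<Rightarrow> bool" where
  "commensurated X \<equiv> X \<in> left_commensurated G T"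

lemma compactin_subset_carrier: "compactin T C \<Longrightarrow> C \<subseteq> carrier G"
  using compactin_subset_topspace topspace_eq by metis

lemma inv_mult_cancel_left: "g \<in> carrier G \<Longrightarrow> x \<in> carrier G \<Longrightarrow> inv g \<otimes> (g \<otimes> x) = x"
  by (simp add: m_assoc[symmetric])

lemma mult_inv_cancel_right:
  assumes "g \<in> carrier G" "x \<in> carrier G"
  shows "(x \<otimes> g) \<otimes> inv g = x" "(x \<otimes> inv g) \<otimes> g = x"
  using assms by (simp_all add: m_assoc)

lemma rel_compactI:
  assumes "compactin T C" "S \<subseteq> C"
  shows "rel_compact S"
proof -
  have "closedin T C"
    using assms(1) Hausdorff compactin_imp_closedin by blast
  then have "T closure_of S \<subseteq> C"
    using assms(2) by (rule closure_of_minimal[rotated])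
  then show ?thesis
    unfolding has_compact_closure_def using assms(1) closed_compactin closedin_closure_of by blast
qed

lemma rel_compactE:
  assumes "rel_compact S" "S \<subseteq> carrier G"
  obtains C where "compactin T C" "S \<subseteq> C"
  using assms closure_of_subset unfolding has_compact_closure_def topspace_eq[symmetric] by blast

lemma rel_compact_subset:
  assumes "rel_compact B" "A \<subseteq> B"
  shows "rel_compact A"
  using assms closure_of_mono closed_compactin closedin_closure_of
  unfolding has_compact_closure_def by metis

lemma rel_compact_empty: "rel_compact {}"
  by (rule rel_compactI[of "{}"]) auto

lemma rel_compact_Un:
  assumes "rel_compact A" "rel_compact B"
  shows "rel_compact (A \<union> B)"
  using assms compactin_Un unfolding has_compact_closure_def closure_of_Un by blast

lemma compactin_set_mult:
  assumes "compactin T A" "compactin T B"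
  shows "compactin T (A <#> B)"
proof -
  have "A <#> B = (\<lambda>(x, y). x \<otimes> y) ` (A \<times> B)"
    unfolding set_mult_def by auto
  moreover have "compactin (prod_topology T T) (A \<times> B)"
    using assms by (simp add: compactin_Times)
  ultimately show ?thesis
    using image_compactin continuous_mult by metis
qed

lemma compactin_image_inv: "compactin T A \<Longrightarrow> compactin T ((\<lambda>x. inv x) ` A)"
  using image_compactin continuous_inv by blast

lemma continuous_right_translation:
  assumes "g \<in> carrier G"
  shows "continuous_map T T (\<lambda>x. x \<otimes> g)"
proof -
  have "continuous_map T (prod_topology T T) (\<lambda>x. (x, g))"
    using assms topspace_eq by (simp add: continuous_map_pairwise o_def)
  from continuous_map_compose[OF this continuous_mult] show ?thesis
    by (simp add: o_def)
qed

lemma openin_r_coset: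
  assumes "openin T U" "g \<in> carrier G"
  shows "openin T (U #> g)"
proof -
  have U: "U \<subseteq> carrier G"
    using assms(1) openin_subset topspace_eq by metis
  have "U #> g = {x \<in> topspace T. x \<otimes> inv g \<in> U}"
  proof safe
    fix x assume "x \<in> U #> g"
    then obtain u where "u \<in> U" "x = u \<otimes> g"
      by (auto simp: r_coset_def)
    then show "x \<in> topspace T" "x \<otimes> inv g \<in> U"
      using U assms(2) topspace_eq by (auto simp: m_assoc)
  next
    fix x assume "x \<in> topspace T" "x \<otimes> inv g \<in> U"
    moreover have "x = (x \<otimes> inv g) \<otimes> g"
      using \<open>x \<in> topspace T\<close> assms(2) topspace_eq by (simp add: m_assoc)
    ultimately show "x \<in> U #> g"
      unfolding r_coset_def by blast
  qed
  then show ?thesis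
    using openin_continuous_map_preimage[OF continuous_right_translation assms(1)] assms(2) by simp
qed

lemma compactin_r_coset:
  assumes "compactin T C" "g \<in> carrier G"
  shows "compactin T (C #> g)"
proof -
  have "C #> g = (\<lambda>x. x \<otimes> g) ` C"
    by (auto simp: r_coset_def)
  then show ?thesis
    using image_compactin[OF assms(1) continuous_right_translation[OF assms(2)]] by simp
qed

lemma rel_compact_r_coset_iff:
  assumes "A \<subseteq> carrier G" "g \<in> carrier G"
  shows "rel_compact (A #> g) \<longleftrightarrow> rel_compact A"
proof -
  have *: "rel_compact (B #> h)" if B: "rel_compact B" "B \<subseteq> carrier G" and h: "h \<in> carrier G" for B h
  proof -
    obtain C where "compactin T C" "B \<subseteq> C"
      by (rule rel_compactE[OF B])
    then show ?thesis
      using h by (intro rel_compactI[OF compactin_r_coset[of C h]]) (auto simp: r_coset_def)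
  qed
  have "(A #> g) #> inv g = A"
    using assms by (simp add: coset_mult_assoc)
  then show ?thesis
    using *[of A g] *[of "A #> g" "inv g"] assms r_coset_subset_G by auto
qed

section \<open>Commensurated subsets\<close>

text \<open>
  A working form of commensuration that avoids closures: for compact \<open>K\<close>, the edges of the left
  Cayley graph of \<open>K\<close> that leave \<open>A\<close> end in a compact set.
\<close>
lemma commensurated_iff:
  "commensurated A \<longleftrightarrow> A \<subseteq> carrier G \<and>
     (\<forall>K. compactin T K \<longrightarrow> (\<exists>C. compactin T C \<and> (\<forall>k\<in>K. \<forall>x\<in>A. k \<otimes> x \<in> A \<union> C)))"
proof -
  have "rel_compact ((K <#> A) - A) \<longleftrightarrow> (\<exists>C. compactin T C \<and> (\<forall>k\<in>K. \<forall>x\<in>A. k \<otimes> x \<in> A \<union> C))"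
    if A: "A \<subseteq> carrier G" and K: "compactin T K" for K
  proof -
    have sub: "(K <#> A) - A \<subseteq> carrier G"
      using set_mult_closed[OF compactin_subset_carrier[OF K] A] by blast
    have "rel_compact ((K <#> A) - A) \<longleftrightarrow> (\<exists>C. compactin T C \<and> (K <#> A) - A \<subseteq> C)"
      using sub rel_compactE rel_compactI by metis
    also have "\<dots> \<longleftrightarrow> (\<exists>C. compactin T C \<and> (\<forall>k\<in>K. \<forall>x\<in>A. k \<otimes> x \<in> A \<union> C))"
      by (rule ex_cong1) (auto simp: set_mult_def)
    finally show ?thesis .
  qed
  then show ?thesis
    unfolding left_commensurated_def by auto
qed

lemma commensurated_subset_carrier: "commensurated A \<Longrightarrow> A \<subseteq> carrier G"
  by (simp add: left_commensurated_def)

lemma commensuratedE: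
  assumes "commensurated A" "compactin T K"
  obtains C where "compactin T C" "\<And>k x. k \<in> K \<Longrightarrow> x \<in> A \<Longrightarrow> k \<otimes> x \<in> A \<union> C"
  using assms unfolding commensurated_iff by blast

lemma commensurated_empty: "commensurated {}"
  unfolding commensurated_iff by (auto intro: exI[of _ "{}"])

lemma commensurated_Int:
  assumes "commensurated A" "commensurated B"
  shows "commensurated (A \<inter> B)"
  unfolding commensurated_iff
proof (intro conjI allI impI)
  show "A \<inter> B \<subseteq> carrier G"
    using assms commensurated_subset_carrier by blast
  fix K assume K: "compactin T K"
  obtain C where C: "compactin T C" "\<And>k x. k \<in> K \<Longrightarrow> x \<in> A \<Longrightarrow> k \<otimes> x \<in> A \<union> C"
    by (rule commensuratedE[OF assms(1) K], rule that)
  obtain D where D: "compactin T D" "\<And>k x. k \<in> K \<Longrightarrow> x \<in> B \<Longrightarrow> k \<otimes> x \<in> B \<union> D"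
    by (rule commensuratedE[OF assms(2) K], rule that)
  show "\<exists>C. compactin T C \<and> (\<forall>k\<in>K. \<forall>x\<in>A \<inter> B. k \<otimes> x \<in> A \<inter> B \<union> C)"
    using C D by (intro exI[of _ "C \<union> D"]) (auto simp: compactin_Un)
qed

text \<open>
  An edge from \<open>x \<notin> A\<close> to \<open>k x \<in> A\<close>, read backwards, leaves \<open>A\<close> along \<open>k\<inverse>\<close>. Hence its end \<open>x\<close>
  lies in a compact set \<open>C\<close>, and \<open>k x\<close> lies in \<open>K C\<close>.
\<close>
lemma commensurated_compl:
  assumes "commensurated A"
  shows "commensurated (carrier G - A)"
  unfolding commensurated_iff
proof (intro conjI allI impI)
  show "carrier G - A \<subseteq> carrier G" by blast
  fix K assume K: "compactin T K"
  let ?K' = "(\<lambda>x. inv x) ` K"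
  obtain C where C: "compactin T C" "\<And>k x. k \<in> ?K' \<Longrightarrow> x \<in> A \<Longrightarrow> k \<otimes> x \<in> A \<union> C"
    by (rule commensuratedE[OF assms compactin_image_inv[OF K]], rule that)
  have "k \<otimes> x \<in> carrier G - A \<union> (K <#> C)" if k: "k \<in> K" and x: "x \<in> carrier G - A" for k x
  proof (cases "k \<otimes> x \<in> A")
    case True
    have kc: "k \<in> carrier G"
      using k K compactin_subset_carrier by blast
    have "inv k \<otimes> (k \<otimes> x) = x"
      using kc x by (simp add: inv_mult_cancel_left)
    then have "x \<in> C"
      using C(2)[OF imageI[OF k] True] x by auto
    then show ?thesis
      using k by (auto simp: set_mult_def)
  next
    case False
    then show ?thesis
      using k x K compactin_subset_carrier by auto
  qed
  then show "\<exists>C. compactin T C \<and> (\<forall>k\<in>K. \<forall>x\<in>carrier G - A. k \<otimes> x \<in> carrier G - A \<union> C)"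
    using compactin_set_mult[OF K C(1)] by blast
qed

lemma commensurated_Diff:
  assumes "commensurated A" "commensurated B"
  shows "commensurated (A - B)"
proof -
  have "A - B = A \<inter> (carrier G - B)"
    using assms commensurated_subset_carrier by blast
  then show ?thesis
    using assms commensurated_Int commensurated_compl by simp
qed

text \<open>
  Left and right translations commute, so right translation permutes the commensurated sets. This
  action on the space of ends is what moves pieces of \<open>G\<close> into an alleged atom.
\<close>
lemma commensurated_r_coset:
  assumes "commensurated A" "g \<in> carrier G"
  shows "commensurated (A #> g)"
  unfolding commensurated_iff
proof (intro conjI allI impI)
  have A: "A \<subseteq> carrier G"
    using assms(1) commensurated_subset_carrier by blast
  then show "A #> g \<subseteq> carrier G"
    using assms(2) r_coset_subset_G by blast
  fix K assume K: "compactin T K"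
  obtain C where C: "compactin T C" "\<And>k x. k \<in> K \<Longrightarrow> x \<in> A \<Longrightarrow> k \<otimes> x \<in> A \<union> C"
    by (rule commensuratedE[OF assms(1) K], rule that)
  have "k \<otimes> y \<in> (A #> g) \<union> (C #> g)" if k: "k \<in> K" and y: "y \<in> A #> g" for k y
  proof -
    obtain x where x: "x \<in> A" "y = x \<otimes> g"
      using y by (auto simp: r_coset_def)
    have "k \<otimes> y = (k \<otimes> x) \<otimes> g"
      using x A assms(2) k K compactin_subset_carrier by (metis m_assoc subsetD)
    then show ?thesis
      using C(2)[OF k x(1)] by (auto simp: r_coset_def)
  qed
  then show "\<exists>C. compactin T C \<and> (\<forall>k\<in>K. \<forall>x\<in>A #> g. k \<otimes> x \<in> (A #> g) \<union> C)"
    using compactin_r_coset[OF C(1) assms(2)] by blast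
qed

section \<open>Compactly generated open subgroups\<close>

text \<open>
  Every compact set lies in a set of this kind, which generates an open subgroup whose elements are
  words without inverses.
\<close>
definition symmetric_nbhd :: "'a set \<Rightarrow> bool" where
  "symmetric_nbhd K \<longleftrightarrow> compactin T K \<and> (\<forall>k\<in>K. inv k \<in> K) \<and> (\<exists>U. openin T U \<and> \<one> \<in> U \<and> U \<subseteq> K)"

lemma symmetric_nbhdD:
  assumes "symmetric_nbhd K"
  shows "compactin T K" "K \<subseteq> carrier G" "\<And>k. k \<in> K \<Longrightarrow> inv k \<in> K" "\<one> \<in> K"
  using assms compactin_subset_carrier unfolding symmetric_nbhd_def by auto

lemma ex_symmetric_nbhd:
  assumes "compactin T C"
  obtains K where "symmetric_nbhd K" "C \<subseteq> K"
proof -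
  obtain U N where U: "openin T U" "\<one> \<in> U" "U \<subseteq> N" and N: "compactin T N"
    using locally_compact topspace_eq unfolding locally_compact_space_def by (metis one_closed)
  let ?D = "C \<union> N"
  let ?K = "?D \<union> (\<lambda>x. inv x) ` ?D"
  have D: "compactin T ?D"
    using assms N compactin_Un by blast
  have "compactin T ?K"
    using D compactin_Un compactin_image_inv by blast
  moreover have "inv k \<in> ?K" if "k \<in> ?K" for k
    using that compactin_subset_carrier[OF D] by (auto simp: subset_iff)
  ultimately have "symmetric_nbhd ?K"
    unfolding symmetric_nbhd_def using U by blast
  then show ?thesis
    using that by blast
qed

text \<open>
  Each \<open>S n\<close> lies in the open subset \<open>U (S n)\<close> of \<open>S (Suc n)\<close>, so a compact subset of the union is
  absorbed by some \<open>S n\<close>. A compact set \<open>C\<close> which is not contained in the union reduces to this case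
  because an open subgroup is also closed.
\<close>
lemma compactin_exhaustion:
  assumes U: "openin T U" "\<one> \<in> U" and carr: "\<And>n. S n \<subseteq> carrier G"
    and thick: "\<And>n u x. u \<in> U \<Longrightarrow> x \<in> S n \<Longrightarrow> u \<otimes> x \<in> S (Suc n)"
    and sub: "subgroup (\<Union>n. S n) G" and one: "\<one> \<in> S 0"
    and C: "compactin T C"
  obtains n :: nat where "C \<inter> (\<Union>n. S n) \<subseteq> S n"
proof -
  define M where "M = (\<Union>n. S n)"
  have Uc: "U \<subseteq> carrier G"
    using U(1) openin_subset topspace_eq by metis
  have U_S: "U #> x \<subseteq> S (Suc n)" if "x \<in> S n" for x n
    using that thick by (auto simp: r_coset_def)
  have self: "x \<in> U #> x" if "x \<in> carrier G" for x
    using U(2) that by (force simp: r_coset_def)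
  have UM: "U \<subseteq> M"
  proof
    fix u assume "u \<in> U"
    then have "u \<otimes> \<one> \<in> S (Suc 0)"
      using thick one by blast
    then show "u \<in> M"
      using \<open>u \<in> U\<close> Uc unfolding M_def by (metis UN_I UNIV_I r_one subsetD)
  qed
  have subM: "subgroup M G"
    using sub by (simp add: M_def)
  have mono: "S m \<subseteq> S n" if "m \<le> n" for m n
  proof (rule lift_Suc_mono_le[of S, OF _ that])
    fix n
    have "\<one> \<otimes> x \<in> S (Suc n)" if "x \<in> S n" for x
      using thick U(2) that by blast
    then show "S n \<subseteq> S (Suc n)"
      using carr by (metis l_one subsetD subsetI)
  qed
  have "openin T (carrier G - M)"
  proof (subst openin_subopen, intro ballI)
    fix y assume y: "y \<in> carrier G - M"
    have "U #> y \<subseteq> carrier G - M"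
    proof
      fix z assume "z \<in> U #> y"
      then obtain u where u: "u \<in> U" "z = u \<otimes> y"
        by (auto simp: r_coset_def)
      have "y \<in> M" if "z \<in> M"
      proof -
        have "y = inv u \<otimes> z"
          using u Uc y inv_mult_cancel_left[of u y] by auto
        then show ?thesis
          using that UM u(1) subM by (auto intro: subgroup.m_closed subgroup.m_inv_closed)
      qed
      then show "z \<in> carrier G - M"
        using u Uc y by auto
    qed
    then show "\<exists>V. openin T V \<and> y \<in> V \<and> V \<subseteq> carrier G - M"
      using openin_r_coset[OF U(1)] self y by blast
  qed
  moreover have "M \<subseteq> carrier G"
    using subM subgroup.subset by blast
  ultimately have "closedin T M"
    by (simp add: closedin_def topspace_eq)
  then have CM: "compactin T (C \<inter> M)"
    using C compact_Int_closedin by blast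
  define W where "W n = (\<Union>x\<in>S n. U #> x)" for n
  have "\<forall>V\<in>range W. openin T V"
    unfolding W_def using openin_r_coset[OF U(1)] carr by blast
  moreover have "C \<inter> M \<subseteq> \<Union>(range W)"
    unfolding W_def M_def using self carr by blast
  ultimately obtain \<F> where F: "finite \<F>" "\<F> \<subseteq> range W" "C \<inter> M \<subseteq> \<Union>\<F>"
    using CM unfolding compactin_def by metis
  then obtain I where I: "finite I" "\<F> = W ` I"
    by (meson finite_subset_image)
  obtain N where N: "\<And>i. i \<in> I \<Longrightarrow> i < N"
    using I(1) finite_nat_bounded[OF I(1)] by auto
  have "W i \<subseteq> S N" if "i \<in> I" for i
    unfolding W_def using U_S mono[of "Suc i" N] N[OF that] by fastforce
  then have "C \<inter> M \<subseteq> S N"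
    using F(3) I(2) by blast
  then show ?thesis
    using that unfolding M_def by blast
qed

text \<open>
  Balls around the identity in the Cayley graph, with edges given by left multiplication; right
  translations are then graph automorphisms.
\<close>
primrec word_ball :: "'a set \<Rightarrow> nat \<Rightarrow> 'a set" where
  "word_ball K 0 = {\<one>}"
| "word_ball K (Suc n) = K <#> word_ball K n"

lemma compactin_word_ball: "compactin T K \<Longrightarrow> compactin T (word_ball K n)"
  by (induction n) (auto simp: compactin_set_mult topspace_eq)

lemma word_ball_mono:
  assumes "symmetric_nbhd K"
  shows "word_ball K n \<subseteq> word_ball K (Suc n)"
proof
  fix x assume x: "x \<in> word_ball K n"
  then have "x \<in> carrier G"
    using compactin_word_ball[of K n] symmetric_nbhdD(1)[OF assms] compactin_subset_carrier by blast
  then show "x \<in> word_ball K (Suc n)"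
    using x symmetric_nbhdD(4)[OF assms] by (force simp: set_mult_def)
qed

lemma generate_eq_word_balls:
  assumes K: "symmetric_nbhd K"
  shows "generate G K = (\<Union>n. word_ball K n)"
proof
  note KD = symmetric_nbhdD[OF K]
  have step: "k \<otimes> x \<in> (\<Union>n. word_ball K n)" if k: "k \<in> K" and x: "x \<in> (\<Union>n. word_ball K n)" for k x
  proof -
    obtain n where "x \<in> word_ball K n"
      using x by blast
    then have "k \<otimes> x \<in> word_ball K (Suc n)"
      using k by (auto simp: set_mult_def)
    then show ?thesis by blast
  qed
  have carr: "(\<Union>n. word_ball K n) \<subseteq> carrier G"
    using compactin_word_ball[OF KD(1)] compactin_subset_carrier by blast
  have "\<forall>x\<in>(\<Union>n. word_ball K n). h \<otimes> x \<in> (\<Union>n. word_ball K n)" if "h \<in> generate G K" for h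
    using that
  proof (induction rule: generate.induct)
    case one
    show ?case
      using carr by (metis l_one subsetD)
  next
    case (incl k)
    then show ?case
      using step by blast
  next
    case (inv k)
    then show ?case
      using step KD(3) by blast
  next
    case (eng h1 h2)
    then have "h1 \<in> carrier G" "h2 \<in> carrier G"
      using generate_in_carrier[OF KD(2)] by auto
    then show ?case
      using eng carr by (metis m_assoc subsetD)
  qed
  moreover have "\<one> \<in> (\<Union>n. word_ball K n)"
    by (rule UN_I[of 0]) auto
  ultimately show "generate G K \<subseteq> (\<Union>n. word_ball K n)"
    using generate_in_carrier[OF KD(2)] by (metis r_one subsetI)
  have "word_ball K n \<subseteq> generate G K" for n
    by (induction n) (auto simp: set_mult_def intro: generate.intros)
  then show "(\<Union>n. word_ball K n) \<subseteq> generate G K"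
    by blast
qed

text \<open>
  Bounded subsets of \<open>\<langle>K\<rangle>\<close> have bounded word length.
\<close>
lemma compactin_Int_generate:
  assumes K: "symmetric_nbhd K" and C: "compactin T C"
  obtains n where "C \<inter> generate G K \<subseteq> word_ball K n"
proof -
  note KD = symmetric_nbhdD[OF K]
  obtain U where U: "openin T U" "\<one> \<in> U" "U \<subseteq> K"
    using K unfolding symmetric_nbhd_def by blast
  obtain n where "C \<inter> (\<Union>n. word_ball K n) \<subseteq> word_ball K n"
  proof (rule compactin_exhaustion[OF U(1,2) _ _ _ _ C, of "word_ball K"])
    show "word_ball K n \<subseteq> carrier G" for n
      using compactin_word_ball[OF KD(1)] compactin_subset_carrier by blast
    show "u \<otimes> x \<in> word_ball K (Suc n)" if "u \<in> U" "x \<in> word_ball K n" for n u x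
      using that U(3) by (auto simp: set_mult_def)
    show "subgroup (\<Union>n. word_ball K n) G"
      using generate_is_subgroup[OF KD(2)] generate_eq_word_balls[OF K] by simp
  qed auto
  then show ?thesis
    using that generate_eq_word_balls[OF K] by simp
qed

text \<open>
  Induction along a path in the coset \<open>\<langle>K\<rangle> x\<close> of the Cayley graph: a property that survives left
  multiplication by \<open>K\<close> spreads from \<open>x\<close> to the whole coset.
\<close>
lemma generate_induct_left:
  assumes K: "symmetric_nbhd K" and "h \<in> generate G K" and x: "x \<in> carrier G" "P x"
    and step: "\<And>k y. k \<in> K \<Longrightarrow> y \<in> carrier G \<Longrightarrow> P y \<Longrightarrow> P (k \<otimes> y)"
  shows "P (h \<otimes> x)"
proof -
  note KD = symmetric_nbhdD[OF K]
  have "\<forall>y\<in>carrier G. P y \<longrightarrow> P (h \<otimes> y)"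
    using assms(2)
  proof (induction rule: generate.induct)
    case one
    then show ?case by simp
  next
    case (incl k)
    then show ?case using step by blast
  next
    case (inv k)
    then show ?case using step KD(3) by blast
  next
    case (eng h1 h2)
    then have "h1 \<in> carrier G" "h2 \<in> carrier G"
      using generate_in_carrier[OF KD(2)] by auto
    then show ?case
      using eng by (metis m_assoc m_closed)
  qed
  then show ?thesis
    using x by blast
qed

text \<open>
  Let \<open>C\<close> be a compact set that contains the ends of all edges leaving \<open>A\<close> along \<open>K\<close>. A coset
  \<open>\<langle>K\<rangle> a\<close> with \<open>a \<in> A\<close> that misses \<open>C\<close> lies in \<open>A\<close>, and then adding \<open>a\<close> to the generators
  makes the intersection with \<open>A\<close> unbounded. If there is no such coset then \<open>A \<subseteq> \<langle>K\<rangle> C\<close>, and adding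
  \<open>C\<close> to the generators captures all of \<open>A\<close>.
\<close>
lemma ex_generate_meets_unbounded:
  assumes K: "symmetric_nbhd K" and H: "\<not> rel_compact (generate G K)"
    and A: "commensurated A" "\<not> rel_compact A"
  shows "\<exists>K'. symmetric_nbhd K' \<and> K \<subseteq> K' \<and> \<not> rel_compact (A \<inter> generate G K')"
proof (rule ccontr)
  assume "\<not> ?thesis"
  then have rc: "rel_compact (A \<inter> generate G K')" if "symmetric_nbhd K'" "K \<subseteq> K'" for K'
    using that by blast
  note KD = symmetric_nbhdD[OF K]
  have Ac: "A \<subseteq> carrier G"
    using A(1) commensurated_subset_carrier by blast
  obtain C where C: "compactin T C" "\<And>k x. k \<in> K \<Longrightarrow> x \<in> A \<Longrightarrow> k \<otimes> x \<in> A \<union> C"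
    by (rule commensuratedE[OF A(1) KD(1)], rule that)
  have meets: "\<exists>h\<in>generate G K. h \<otimes> a \<in> C" if a: "a \<in> A" for a
  proof (rule ccontr)
    assume no: "\<not> (\<exists>h\<in>generate G K. h \<otimes> a \<in> C)"
    have aG: "a \<in> carrier G"
      using a Ac by blast
    \<comment> \<open>The path from \<open>a\<close> stays in the coset \<open>\<langle>K\<rangle> a\<close>, which misses \<open>C\<close>, so it never leaves \<open>A\<close>.\<close>
    have in_A: "h \<otimes> a \<in> A" if "h \<in> generate G K" for h
    proof -
      have "(\<exists>g\<in>generate G K. h \<otimes> a = g \<otimes> a) \<and> h \<otimes> a \<in> A"
      proof (rule generate_induct_left[OF K that aG])
        show "(\<exists>g\<in>generate G K. a = g \<otimes> a) \<and> a \<in> A"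
          using a aG generate.one[of G K] by force
        fix k y assume k: "k \<in> K" and y: "y \<in> carrier G" "(\<exists>g\<in>generate G K. y = g \<otimes> a) \<and> y \<in> A"
        then obtain g where g: "g \<in> generate G K" "y = g \<otimes> a" by blast
        have "k \<otimes> y = (k \<otimes> g) \<otimes> a"
          using g k KD(2) aG generate_in_carrier[OF KD(2)] by (metis m_assoc subsetD)
        moreover have kg: "k \<otimes> g \<in> generate G K"
          using g k by (auto intro: generate.intros)
        ultimately show "(\<exists>g\<in>generate G K. k \<otimes> y = g \<otimes> a) \<and> k \<otimes> y \<in> A"
          using C(2)[OF k, of y] y no by (metis Un_iff)
      qed
      then show ?thesis by blast
    qed
    obtain K' where K': "symmetric_nbhd K'" "K \<union> {a} \<subseteq> K'"
      using ex_symmetric_nbhd[of "K \<union> {a}"] KD(1) aG topspace_eq compactin_Un compactin_sing by metis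
    have "generate G K #> a \<subseteq> A \<inter> generate G K'"
    proof
      fix z assume "z \<in> generate G K #> a"
      then obtain h where "h \<in> generate G K" "z = h \<otimes> a"
        by (auto simp: r_coset_def)
      then show "z \<in> A \<inter> generate G K'"
        using in_A mono_generate[of K K'] K'(2) by (auto intro: generate.intros)
    qed
    then have "rel_compact (generate G K #> a)"
      using rc K' rel_compact_subset by blast
    then show False
      using H rel_compact_r_coset_iff[OF generate_incl[OF KD(2)] aG] by simp
  qed
  obtain K' where K': "symmetric_nbhd K'" "K \<union> C \<subseteq> K'"
    by (rule ex_symmetric_nbhd[OF compactin_Un[OF KD(1) C(1)]])
  have "A \<subseteq> generate G K'"
  proof
    fix a assume a: "a \<in> A"
    then obtain h where h: "h \<in> generate G K" "h \<otimes> a \<in> C"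
      using meets by blast
    have sub: "subgroup (generate G K') G"
      using generate_is_subgroup symmetric_nbhdD(2)[OF K'(1)] by blast
    have "h \<in> generate G K'"
      using h(1) mono_generate[of K K'] K'(2) by auto
    moreover have "h \<otimes> a \<in> generate G K'"
      using h(2) K'(2) by (auto intro: generate.incl)
    ultimately have "inv h \<otimes> (h \<otimes> a) \<in> generate G K'"
      using sub subgroup.m_closed subgroup.m_inv_closed by metis
    moreover have "h \<in> carrier G"
      using h(1) generate_in_carrier[OF KD(2)] by blast
    ultimately show "a \<in> generate G K'"
      using a Ac inv_mult_cancel_left[of h a] by auto
  qed
  then have "A \<inter> generate G K' = A" by blast
  then show False
    using rc[OF K'(1)] K'(2) A(2) by simp
qed

section \<open>Splitting inside a compactly generated subgroup\<close>

text \<open>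
  The ball \<open>B\<close> contains the boundaries of \<open>X\<close> and \<open>Z\<close> in \<open>H = \<langle>K\<rangle>\<close>, and \<open>h\<close> is chosen so that
  \<open>B\<close> and \<open>B h\<close> are disjoint. By connectedness \<open>B h\<close>, which contains \<open>h\<close>, stays in \<open>X\<close>, while \<open>B\<close>
  stays outside \<open>Z h\<close>, because \<open>\<one> \<notin> Z h\<close>. Consider the corner \<open>Q = (Z \<inter> H) h - X\<close>. An edge leaving
  \<open>Q\<close> would either enter \<open>X\<close>, and so start in \<open>B\<close>, which misses \<open>Z h\<close>, or leave \<open>Z h\<close>, and so end
  in \<open>B h\<close>, which is contained in \<open>X\<close>. So no edge leaves \<open>Q\<close>; as \<open>h\<close> belongs to \<open>H\<close> but not to
  \<open>Q\<close>, the corner \<open>Q\<close> is empty.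
\<close>
lemma corner_in_compactly_generated:
  assumes K: "symmetric_nbhd K" and X: "commensurated X" and Z: "commensurated Z"
    and B: "B = word_ball K n" and h: "h \<in> X" "h \<in> generate G K" "h \<notin> (\<lambda>x. inv x) ` B <#> B"
    and hZ: "inv h \<notin> Z"
    and bX: "\<And>k x. k \<in> K \<Longrightarrow> x \<in> X \<inter> generate G K \<Longrightarrow> k \<otimes> x \<in> X \<union> B"
    and bZ: "\<And>k x. k \<in> K \<Longrightarrow> x \<in> Z \<inter> generate G K \<Longrightarrow> k \<otimes> x \<in> Z \<union> B"
  shows "(Z \<inter> generate G K) #> h \<subseteq> X"
proof -
  note KD = symmetric_nbhdD[OF K]
  define H where "H = generate G K"
  have HG: "H \<subseteq> carrier G" and sub: "subgroup H G"
    using generate_incl[OF KD(2)] generate_is_subgroup[OF KD(2)] by (auto simp: H_def)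
  have KH: "K \<subseteq> H"
    unfolding H_def by (auto intro: generate.incl)
  have ball_H: "word_ball K m \<subseteq> H" for m
    unfolding H_def generate_eq_word_balls[OF K] by blast
  have hH: "h \<in> H" and hG: "h \<in> carrier G"
    using h(2) HG by (auto simp: H_def)
  have ball_mono: "word_ball K m \<subseteq> B" if "m \<le> n" for m
    unfolding B using lift_Suc_mono_le[of "word_ball K", OF word_ball_mono[OF K] that] .
  have disj: "b \<otimes> h \<notin> B" if b: "b \<in> B" for b
  proof
    assume "b \<otimes> h \<in> B"
    moreover have "inv b \<otimes> (b \<otimes> h) = h"
      using b ball_H HG hG B by (intro inv_mult_cancel_left) auto
    ultimately show False
      using h(3) b unfolding set_mult_def by force
  qed
  have disj': "b \<otimes> inv h \<notin> B" if b: "b \<in> B" for b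
  proof
    assume *: "b \<otimes> inv h \<in> B"
    have "(b \<otimes> inv h) \<otimes> h = b"
      using b ball_H HG hG B by (intro mult_inv_cancel_right) auto
    then show False
      using disj[OF *] b by simp
  qed
  have ball_X: "m \<le> n \<Longrightarrow> x \<in> word_ball K m \<Longrightarrow> x \<otimes> h \<in> X" for m x
  proof (induction m arbitrary: x)
    case 0
    then show ?case
      using h(1) hG by simp
  next
    case (Suc m)
    then obtain k y where ky: "k \<in> K" "y \<in> word_ball K m" "x = k \<otimes> y"
      by (auto simp: set_mult_def)
    have "y \<otimes> h \<in> X \<inter> H"
      using Suc ky ball_H hH sub by (auto intro: subgroup.m_closed)
    then have "k \<otimes> (y \<otimes> h) \<in> X \<union> B"
      using bX ky(1) by (auto simp: H_def)
    moreover have "k \<otimes> (y \<otimes> h) = x \<otimes> h"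
      using ky ball_H HG hG KD(2) by (metis m_assoc subsetD)
    moreover have "x \<otimes> h \<notin> B"
      using disj ball_mono Suc.prems by blast
    ultimately show ?case by simp
  qed
  \<comment> \<open>Edges that enter \<open>Y\<close> start in \<open>B\<close>: read backwards along \<open>k\<inverse>\<close>, they leave \<open>Y\<close>.\<close>
  have enter: "x \<in> Y \<union> B" if k: "k \<in> K" and x: "x \<in> H" and kx: "k \<otimes> x \<in> Y"
    and bY: "\<And>k x. k \<in> K \<Longrightarrow> x \<in> Y \<inter> generate G K \<Longrightarrow> k \<otimes> x \<in> Y \<union> B" for k x Y
  proof -
    have "k \<otimes> x \<in> H"
      using k x KH sub by (auto intro: subgroup.m_closed)
    then have "inv k \<otimes> (k \<otimes> x) \<in> Y \<union> B"
      using bY[OF KD(3)[OF k]] kx by (auto simp: H_def)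
    moreover have "inv k \<otimes> (k \<otimes> x) = x"
      using k x KD(2) HG by (intro inv_mult_cancel_left) auto
    ultimately show ?thesis by simp
  qed
  have ball_Z: "m \<le> n \<Longrightarrow> x \<in> word_ball K m \<Longrightarrow> x \<otimes> inv h \<notin> Z" for m x
  proof (induction m arbitrary: x)
    case 0
    then show ?case
      using hZ hG by simp
  next
    case (Suc m)
    then obtain k y where ky: "k \<in> K" "y \<in> word_ball K m" "x = k \<otimes> y"
      by (auto simp: set_mult_def)
    have yH: "y \<otimes> inv h \<in> H"
      using ky ball_H hH sub by (auto intro: subgroup.m_closed subgroup.m_inv_closed)
    have "k \<otimes> (y \<otimes> inv h) = x \<otimes> inv h"
      using ky ball_H HG hG KD(2) by (metis inv_closed m_assoc subsetD)
    moreover have "y \<otimes> inv h \<notin> Z"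
      using Suc ky by simp
    moreover have "y \<otimes> inv h \<notin> B"
      using disj' ball_mono[of m] Suc.prems(1) ky by auto
    ultimately show ?case
      using enter[OF ky(1) yH _ bZ] by auto
  qed
  show ?thesis
  proof
    fix q assume "q \<in> (Z \<inter> generate G K) #> h"
    then obtain z where z: "z \<in> Z" "z \<in> H" "q = z \<otimes> h"
      by (auto simp: r_coset_def H_def)
    show "q \<in> X"
    proof (rule ccontr)
      assume qX: "q \<notin> X"
      let ?P = "\<lambda>y. y \<in> H \<and> y \<notin> X \<and> y \<otimes> inv h \<in> Z"
      have qH: "q \<in> H"
        using z hH sub by (auto intro: subgroup.m_closed)
      have "z = q \<otimes> inv h"
        using z hG HG mult_inv_cancel_right(1)[of h z] by auto
      then have Pq: "?P q"
        using z qX qH by simp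
      have step: "?P (k \<otimes> y)" if k: "k \<in> K" and y: "y \<in> carrier G" "?P y" for k y
      proof -
        have yB: "y \<notin> B"
        proof
          assume "y \<in> B"
          then have "y \<otimes> inv h \<notin> Z"
            using ball_Z[of n] B by simp
          then show False using y by blast
        qed
        have kyH: "k \<otimes> y \<in> H"
          using k y KH sub by (auto intro: subgroup.m_closed)
        have kyX: "k \<otimes> y \<notin> X"
          using enter[OF k _ _ bX, of y] y yB by blast
        have yhH: "y \<otimes> inv h \<in> Z \<inter> H"
          using y hH sub by (auto intro: subgroup.m_closed subgroup.m_inv_closed)
        have assoc: "k \<otimes> (y \<otimes> inv h) = (k \<otimes> y) \<otimes> inv h"
          using k y hG KD(2) by (metis inv_closed m_assoc subsetD)
        have "(k \<otimes> y) \<otimes> inv h \<notin> B"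
        proof
          assume "(k \<otimes> y) \<otimes> inv h \<in> B"
          then have "((k \<otimes> y) \<otimes> inv h) \<otimes> h \<in> X"
            using ball_X[of n] B by simp
          moreover have "((k \<otimes> y) \<otimes> inv h) \<otimes> h = k \<otimes> y"
            using kyH HG hG by (intro mult_inv_cancel_right) auto
          ultimately show False
            using kyX by simp
        qed
        then show ?thesis
          using bZ[OF k, of "y \<otimes> inv h"] yhH assoc kyH kyX by (auto simp: H_def)
      qed
      \<comment> \<open>The invariant corner is nonempty, so it is all of \<open>H\<close> and contains \<open>h \<in> X\<close>.\<close>
      have "h \<otimes> inv q \<in> generate G K"
        using hH qH sub by (auto simp: H_def intro: subgroup.m_closed subgroup.m_inv_closed)
      then have "?P ((h \<otimes> inv q) \<otimes> q)"
      proof (rule generate_induct_left[OF K])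
        show "q \<in> carrier G" using qH HG by blast
        show "?P q" by (rule Pq)
      qed (rule step)
      moreover have "(h \<otimes> inv q) \<otimes> q = h"
        using qH HG hG by (intro mult_inv_cancel_right) auto
      ultimately show False
        using h(1) by simp
    qed
  qed
qed


text \<open>
  The three sets are pairwise disjoint, so \<open>inv h\<close> belongs to at most one of them, and at least two
  of the translates \<open>X h\<close>, \<open>U h\<close>, \<open>V h\<close> are pushed into \<open>X\<close>. One of these two cuts \<open>X\<close>; the other
  one guarantees that what remains is unbounded.
\<close>
lemma split_compactly_generated:
  assumes K: "symmetric_nbhd K" and X: "commensurated X" "\<not> rel_compact (X \<inter> generate G K)"
    and U: "commensurated U" "\<not> rel_compact (U \<inter> generate G K)"
    and V: "commensurated V" "\<not> rel_compact (V \<inter> generate G K)"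
    and disj: "X \<inter> U = {}" "X \<inter> V = {}" "U \<inter> V = {}"
  obtains Y where "commensurated Y" "Y \<subseteq> X" "\<not> rel_compact Y" "\<not> rel_compact (X - Y)"
proof -
  note KD = symmetric_nbhdD[OF K]
  define H where "H = generate G K"
  have HG: "H \<subseteq> carrier G"
    unfolding H_def by (rule generate_incl[OF KD(2)])
  obtain C\<^sub>1 where C1: "compactin T C\<^sub>1" "\<And>k x. k \<in> K \<Longrightarrow> x \<in> X \<Longrightarrow> k \<otimes> x \<in> X \<union> C\<^sub>1"
    by (rule commensuratedE[OF X(1) KD(1)], rule that)
  obtain C\<^sub>2 where C2: "compactin T C\<^sub>2" "\<And>k x. k \<in> K \<Longrightarrow> x \<in> U \<Longrightarrow> k \<otimes> x \<in> U \<union> C\<^sub>2"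
    by (rule commensuratedE[OF U(1) KD(1)], rule that)
  obtain C\<^sub>3 where C3: "compactin T C\<^sub>3" "\<And>k x. k \<in> K \<Longrightarrow> x \<in> V \<Longrightarrow> k \<otimes> x \<in> V \<union> C\<^sub>3"
    by (rule commensuratedE[OF V(1) KD(1)], rule that)
  let ?C = "C\<^sub>1 \<union> C\<^sub>2 \<union> C\<^sub>3"
  have "compactin T ?C"
    using C1(1) C2(1) C3(1) by (simp add: compactin_Un)
  then obtain n where n: "?C \<inter> H \<subseteq> word_ball K n"
    unfolding H_def by (rule compactin_Int_generate[OF K])
  define B where "B = word_ball K n"
  have boundary: "k \<otimes> x \<in> A \<union> B"
    if A: "A = X \<or> A = U \<or> A = V" and k: "k \<in> K" and x: "x \<in> A \<inter> generate G K" for A k x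
  proof -
    have "k \<otimes> x \<in> H"
      using k x unfolding H_def by (auto intro: generate.intros)
    moreover have "k \<otimes> x \<in> A \<union> ?C"
      using A C1(2)[OF k, of x] C2(2)[OF k, of x] C3(2)[OF k, of x] x by auto
    ultimately show ?thesis
      using n by (auto simp: B_def)
  qed
  have "compactin T B"
    unfolding B_def by (rule compactin_word_ball[OF KD(1)])
  then have "compactin T ((\<lambda>x. inv x) ` B <#> B)"
    using compactin_set_mult compactin_image_inv by blast
  then obtain h where h: "h \<in> X" "h \<in> H" "h \<notin> (\<lambda>x. inv x) ` B <#> B"
    using X(2) rel_compactI[of "(\<lambda>x. inv x) ` B <#> B" "X \<inter> H"] unfolding H_def by blast
  have hG: "h \<in> carrier G"
    using h HG by blast
  obtain Z Z' where Z: "Z \<in> {X, U, V}" "Z' \<in> {X, U, V}" "Z \<inter> Z' = {}" "inv h \<notin> Z" "inv h \<notin> Z'"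
  proof -
    consider "inv h \<in> X" | "inv h \<in> U" | "inv h \<notin> X" "inv h \<notin> U" by blast
    then show ?thesis
    proof cases
      case 1
      then show ?thesis using that[of U V] disj by blast
    next
      case 2
      then show ?thesis using that[of X V] disj by blast
    next
      case 3
      then show ?thesis using that[of X U] disj by blast
    qed
  qed
  have A: "commensurated A" "\<not> rel_compact ((A \<inter> H) #> h)" "inv h \<notin> A \<Longrightarrow> (A \<inter> H) #> h \<subseteq> X"
    if AXUV: "A \<in> {X, U, V}" for A
  proof -
    show cA: "commensurated A"
      using AXUV X U V by blast
    have "\<not> rel_compact (A \<inter> H)"
      using AXUV X U V unfolding H_def by blast
    then show "\<not> rel_compact ((A \<inter> H) #> h)"
      using rel_compact_r_coset_iff[of "A \<inter> H" h] HG hG by blast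
    show "(A \<inter> H) #> h \<subseteq> X" if "inv h \<notin> A"
      unfolding H_def
      by (rule corner_in_compactly_generated[OF K X(1) cA B_def h(1) h(2)[unfolded H_def] h(3) that])
        (use boundary AXUV in blast)+
  qed
  define Y where "Y = X \<inter> (Z #> h)"
  show ?thesis
  proof
    show "commensurated Y"
      unfolding Y_def using commensurated_Int[OF X(1) commensurated_r_coset[OF A(1)[OF Z(1)] hG]] .
    show "Y \<subseteq> X"
      by (auto simp: Y_def)
    have "(Z \<inter> H) #> h \<subseteq> Y"
      unfolding Y_def using A(3)[OF Z(1,4)] by (auto simp: r_coset_def)
    then show "\<not> rel_compact Y"
      using A(2)[OF Z(1)] rel_compact_subset by blast
    have "((Z' \<inter> H) #> h) \<inter> (Z #> h) = {}"
    proof (rule equals0I)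
      fix y assume "y \<in> ((Z' \<inter> H) #> h) \<inter> (Z #> h)"
      then obtain z' z where z: "z' \<in> Z'" "z \<in> Z" "z' \<otimes> h = z \<otimes> h"
        by (auto simp: r_coset_def)
      moreover have "z' \<in> carrier G" "z \<in> carrier G"
        using z commensurated_subset_carrier[OF A(1)[OF Z(1)]] commensurated_subset_carrier[OF A(1)[OF Z(2)]]
        by auto
      ultimately show False
        using Z(3) hG by auto
    qed
    then have "(Z' \<inter> H) #> h \<subseteq> X - Y"
      unfolding Y_def using A(3)[OF Z(2,5)] by blast
    then show "\<not> rel_compact (X - Y)"
      using A(2)[OF Z(2)] rel_compact_subset by blast
  qed
qed

section \<open>Splitting along an increasing union of subgroups\<close>

text \<open>
  The sets \<open>S n\<close> are constructed so that \<open>X\<close> is invariant under \<open>M = \<Union> S n\<close> outside \<open>M\<close>. When \<open>M\<close> is a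
  proper subgroup, a coset \<open>M p\<close> inside \<open>X\<close> is a copy of \<open>M\<close> in which \<open>X p\<close> traces the
  partition of \<open>M\<close> by \<open>X\<close>. When \<open>M\<close> is everything, left multiplication by \<open>K \<subseteq> S m\<close> preserves
  all the differences \<open>\<langle>S (n + 1)\<rangle> - \<langle>S n\<rangle>\<close> with \<open>n \<ge> m\<close>, and \<open>X \<inter> \<langle>S m\<rangle>\<close> is bounded, so any union
  of such differences cuts \<open>X\<close> in a commensurated set.
\<close>
lemma split_without_compactly_generated:
  assumes X: "commensurated X" "\<not> rel_compact X" and co: "\<not> rel_compact (carrier G - X)"
    and thin: "\<And>K. symmetric_nbhd K \<Longrightarrow> rel_compact (X \<inter> generate G K)"
  obtains Y where "commensurated Y" "Y \<subseteq> X" "\<not> rel_compact Y" "\<not> rel_compact (X - Y)"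
proof -
  have XG: "X \<subseteq> carrier G"
    using X(1) commensurated_subset_carrier by blast
  \<comment> \<open>Closure under products makes the union a subgroup, and the third condition makes the part of \<open>X\<close>
    outside the union invariant. The last two provide elements showing that \<open>X\<close>, even outside each
    \<open>generate G (S n)\<close>, and its complement are unbounded in the union.\<close>
  let ?Q = "\<lambda>K L. K \<subseteq> L \<and> K <#> K \<subseteq> L \<and> (\<forall>k\<in>K. \<forall>x\<in>X. k \<otimes> x \<in> X \<union> L) \<and>
      (\<exists>x\<in>X \<inter> L. x \<notin> generate G K) \<and> (\<exists>x\<in>(carrier G - X) \<inter> L. x \<notin> K)"
  have "\<exists>S. \<forall>n::nat. symmetric_nbhd (S n) \<and> ?Q (S n) (S (Suc n))"
  proof (rule dependent_nat_choice)
    show "\<exists>K. symmetric_nbhd K"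
      using ex_symmetric_nbhd[OF compactin_empty] by blast
    fix K :: "'a set" and n :: nat
    assume K: "symmetric_nbhd K"
    note KD = symmetric_nbhdD[OF K]
    obtain C where C: "compactin T C" "\<And>k x. k \<in> K \<Longrightarrow> x \<in> X \<Longrightarrow> k \<otimes> x \<in> X \<union> C"
      by (rule commensuratedE[OF X(1) KD(1)], rule that)
    obtain x where x: "x \<in> X" "x \<notin> generate G K"
      using thin[OF K] X(2) by (metis Int_absorb2 subsetI)
    obtain y where y: "y \<in> carrier G - X" "y \<notin> K"
      using co rel_compactI[OF KD(1)] by blast
    have "compactin T {x, y}"
      using x(1) y(1) XG topspace_eq by (auto intro: finite_imp_compactin)
    then have "compactin T (K \<union> (K <#> K) \<union> C \<union> {x, y})"
      using KD(1) C(1) compactin_set_mult compactin_Un by metis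
    then obtain L where L: "symmetric_nbhd L" "K \<union> (K <#> K) \<union> C \<union> {x, y} \<subseteq> L"
      by (rule ex_symmetric_nbhd)
    then have "?Q K L"
      using C(2) x y by blast
    then show "\<exists>L. symmetric_nbhd L \<and> ?Q K L"
      using L(1) by blast
  qed
  then obtain S :: "nat \<Rightarrow> 'a set" where
    S: "\<And>n. symmetric_nbhd (S n)" and inc: "\<And>n. S n \<subseteq> S (Suc n)"
    and mult: "\<And>n. S n <#> S n \<subseteq> S (Suc n)"
    and bd: "\<And>n k x. k \<in> S n \<Longrightarrow> x \<in> X \<Longrightarrow> k \<otimes> x \<in> X \<union> S (Suc n)"
    and newX: "\<And>n. \<exists>x\<in>X \<inter> S (Suc n). x \<notin> generate G (S n)"
    and newco: "\<And>n. \<exists>x\<in>(carrier G - X) \<inter> S (Suc n). x \<notin> S n"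
    by blast
  note SD = symmetric_nbhdD[OF S]
  have mono: "S m \<subseteq> S n" if "m \<le> n" for m n
    using lift_Suc_mono_le[of S, OF inc that] .
  define M where "M = (\<Union>n. S n)"
  have subM: "subgroup M G"
  proof (rule subgroup.intro)
    show "M \<subseteq> carrier G"
      unfolding M_def using SD(2) by blast
    show "\<one> \<in> M"
      unfolding M_def using SD(4) by blast
    show "inv x \<in> M" if "x \<in> M" for x
      using that SD(3) unfolding M_def by blast
    fix x y assume "x \<in> M" "y \<in> M"
    then obtain m n where "x \<in> S m" "y \<in> S n"
      unfolding M_def by blast
    then have "x \<in> S (max m n)" "y \<in> S (max m n)"
      using mono[of m "max m n"] mono[of n "max m n"] by auto
    then show "x \<otimes> y \<in> M"
      using mult[of "max m n"] unfolding M_def set_mult_def by blast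
  qed
  obtain U where U: "openin T U" "\<one> \<in> U" "U \<subseteq> S 0"
    using S[of 0] unfolding symmetric_nbhd_def by blast
  have exh: "\<exists>n. C \<inter> M \<subseteq> S n" if C: "compactin T C" for C
  proof -
    have "u \<otimes> x \<in> S (Suc n)" if ux: "u \<in> U" "x \<in> S n" for u x n
      using ux U(3) mono[of 0 n] mult[of n] unfolding set_mult_def by blast
    then obtain n where "C \<inter> (\<Union>n. S n) \<subseteq> S n"
      using compactin_exhaustion[OF U(1,2) SD(2) _ subM[unfolded M_def] SD(4) C] by metis
    then show ?thesis
      unfolding M_def by blast
  qed
  have unboundedX: "\<not> rel_compact (X \<inter> M)"
  proof
    assume "rel_compact (X \<inter> M)"
    then obtain C where C: "compactin T C" "X \<inter> M \<subseteq> C"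
      using XG by (elim rel_compactE) auto
    obtain n where n: "C \<inter> M \<subseteq> S n"
      using exh[OF C(1)] by blast
    obtain x where "x \<in> X" "x \<in> S (Suc n)" "x \<notin> generate G (S n)"
      using newX[of n] by blast
    then show False
      using n C(2) generate.incl[of x "S n" G] unfolding M_def by blast
  qed
  have unboundedco: "\<not> rel_compact (M - X)"
  proof
    assume "rel_compact (M - X)"
    then obtain C where C: "compactin T C" "M - X \<subseteq> C"
      using subgroup.subset[OF subM] by (elim rel_compactE) auto
    obtain n where n: "C \<inter> M \<subseteq> S n"
      using exh[OF C(1)] by blast
    obtain x where "x \<in> carrier G - X" "x \<in> S (Suc n)" "x \<notin> S n"
      using newco[of n] by blast
    then show False
      using n C(2) unfolding M_def by blast
  qed
  show ?thesis
  proof (cases "M = carrier G")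
    case False
    \<comment> \<open>Otherwise left translation by \<open>p \<notin> M\<close> would make \<open>p X\<close> disjoint from \<open>X\<close>.\<close>
    have "\<not> X \<subseteq> M"
    proof
      assume XM: "X \<subseteq> M"
      obtain p where p: "p \<in> carrier G" "p \<notin> M"
        using False subgroup.subset[OF subM] by blast
      have compact_p: "compactin T {p}"
        using p topspace_eq by simp
      obtain C where C: "compactin T C" "\<And>k x. k \<in> {p} \<Longrightarrow> x \<in> X \<Longrightarrow> k \<otimes> x \<in> X \<union> C"
        by (rule commensuratedE[OF X(1) compact_p], rule that)
      have "X \<subseteq> {inv p} <#> C"
      proof
        fix x assume x: "x \<in> X"
        have "p \<otimes> x \<notin> M"
        proof
          assume "p \<otimes> x \<in> M"
          then have "(p \<otimes> x) \<otimes> inv x \<in> M"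
            using x XM subM by (auto intro: subgroup.m_closed subgroup.m_inv_closed)
          then show False
            using mult_inv_cancel_right(1)[of x p] p x XG by auto
        qed
        then have "p \<otimes> x \<in> C"
          using C(2)[of p x] x XM by blast
        moreover have "x = inv p \<otimes> (p \<otimes> x)"
          using inv_mult_cancel_left[of p x] p x XG by auto
        ultimately show "x \<in> {inv p} <#> C"
          unfolding set_mult_def by blast
      qed
      moreover have "compactin T ({inv p} <#> C)"
        using p C(1) topspace_eq by (intro compactin_set_mult) auto
      ultimately show False
        using X(2) rel_compactI by blast
    qed
    then obtain p where p: "p \<in> X" "p \<notin> M"
      by blast
    have pG: "p \<in> carrier G"
      using p XG by blast
    \<comment> \<open>An edge that leaves \<open>X\<close> along \<open>m \<in> M\<close> ends in \<open>M\<close>; starting from \<open>p \<notin> M\<close> this cannot happen.\<close>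
    have Mp: "m \<otimes> p \<in> X" if m: "m \<in> M" for m
    proof (rule ccontr)
      assume "m \<otimes> p \<notin> X"
      moreover obtain n where "m \<in> S n"
        using m unfolding M_def by blast
      ultimately have "m \<otimes> p \<in> M"
        using bd[of m n p] p(1) unfolding M_def by blast
      then have "inv m \<otimes> (m \<otimes> p) \<in> M"
        using m subM by (auto intro: subgroup.m_closed subgroup.m_inv_closed)
      then show False
        using inv_mult_cancel_left[of m p] m pG p(2) subgroup.subset[OF subM] by auto
    qed
    define Y where "Y = X \<inter> (X #> p)"
    show ?thesis
    proof
      show "commensurated Y"
        unfolding Y_def using commensurated_Int[OF X(1) commensurated_r_coset[OF X(1) pG]] .
      show "Y \<subseteq> X"
        by (auto simp: Y_def)
      have "(X \<inter> M) #> p \<subseteq> Y"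
        unfolding Y_def using Mp by (auto simp: r_coset_def)
      moreover have "\<not> rel_compact ((X \<inter> M) #> p)"
        using rel_compact_r_coset_iff[of "X \<inter> M" p] XG pG unboundedX by blast
      ultimately show "\<not> rel_compact Y"
        using rel_compact_subset by blast
      have "(M - X) #> p \<subseteq> X - Y"
      proof
        fix z assume "z \<in> (M - X) #> p"
        then obtain m where m: "m \<in> M" "m \<notin> X" "z = m \<otimes> p"
          by (auto simp: r_coset_def)
        have "z \<notin> X #> p"
        proof
          assume "z \<in> X #> p"
          then obtain x where "x \<in> X" "m \<otimes> p = x \<otimes> p"
            using m(3) by (auto simp: r_coset_def)
          then show False
            using m subgroup.subset[OF subM] XG pG by (metis right_cancel subsetD)
        qed
        then show "z \<in> X - Y"
          using Mp m unfolding Y_def by blast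
      qed
      moreover have "\<not> rel_compact ((M - X) #> p)"
        using rel_compact_r_coset_iff[of "M - X" p] subgroup.subset[OF subM] pG unboundedco by blast
      ultimately show "\<not> rel_compact (X - Y)"
        using rel_compact_subset by blast
    qed
  next
    case True
    define H where "H n = generate G (S n)" for n
    have H_sub: "subgroup (H n) G" for n
      unfolding H_def by (rule generate_is_subgroup[OF SD(2)])
    have H_mono: "H m \<subseteq> H n" if "m \<le> n" for m n
      unfolding H_def by (rule mono_generate[OF mono[OF that]])
    have S_H: "S n \<subseteq> H n" for n
      unfolding H_def by (auto intro: generate.incl)
    have exhG: "\<exists>n. C \<subseteq> S n" if C: "compactin T C" for C
      using exh[OF C] compactin_subset_carrier[OF C] True by (simp add: Int_absorb2)
    \<comment> \<open>For \<open>x \<in> H (n + 1) - H n\<close> the level is \<open>n + 1\<close>; only the elements of \<open>H 0\<close> have level \<open>0\<close>.\<close>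
    define level where "level x = (LEAST n. x \<in> H n)" for x
    define Y where "Y = {x \<in> X. even (level x)}"
    have level_step: "level (k \<otimes> x) = level x"
      if k: "k \<in> H m" and x: "x \<in> carrier G" "x \<notin> H m" for k x m
    proof -
      have kG: "k \<in> carrier G"
        using k subgroup.subset[OF H_sub] by blast
      have "k \<otimes> x \<in> H n \<longleftrightarrow> x \<in> H n" for n
      proof (cases "m \<le> n")
        case True
        then have "k \<in> H n"
          using k H_mono by blast
        then show ?thesis
          using H_sub[of n] inv_mult_cancel_left[OF kG x(1)]
          by (metis subgroup.m_closed subgroup.m_inv_closed)
      next
        case False
        then have "H n \<subseteq> H m"
          using H_mono by simp
        moreover have "k \<otimes> x \<notin> H m"
          using k x(2) H_sub[of m] inv_mult_cancel_left[OF kG x(1)]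
          by (metis subgroup.m_closed subgroup.m_inv_closed)
        ultimately show ?thesis
          using x(2) by blast
      qed
      then show ?thesis
        by (simp add: level_def)
    qed
    have level_le: "level x \<le> n" if "x \<in> S n" for x n
      unfolding level_def using that S_H by (intro Least_le) blast
    have level_new: "level x = Suc n" if "x \<in> S (Suc n)" "x \<notin> H n" for x n
      unfolding level_def
    proof (rule Least_equality)
      show "x \<in> H (Suc n)"
        using that(1) S_H by blast
      show "Suc n \<le> i" if "x \<in> H i" for i
        using H_mono[of i n] that \<open>x \<notin> H n\<close> by (meson not_less_eq_eq subsetD)
    qed
    have unbounded: "\<not> rel_compact {x \<in> X. P (level x)}" if P: "\<And>n. \<exists>i\<ge>n. P (Suc i)" for P
    proof
      assume "rel_compact {x \<in> X. P (level x)}"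
      then obtain C where C: "compactin T C" "{x \<in> X. P (level x)} \<subseteq> C"
        using XG by (elim rel_compactE) auto
      obtain n where n: "C \<subseteq> S n"
        using exhG[OF C(1)] by blast
      obtain i where i: "i \<ge> n" "P (Suc i)"
        using P by blast
      obtain x where x: "x \<in> X" "x \<in> S (Suc i)" "x \<notin> H i"
        using newX[of i] unfolding H_def by blast
      have lx: "level x = Suc i"
        using level_new[OF x(2,3)] .
      then have "x \<in> S n"
        using x(1) i(2) C(2) n by auto
      then show False
        using level_le[of x n] lx i(1) by simp
    qed
    show ?thesis
    proof
      show "commensurated Y"
        unfolding commensurated_iff
      proof (intro conjI allI impI)
        show "Y \<subseteq> carrier G"
          using XG by (auto simp: Y_def)
        fix K assume K: "compactin T K"
        obtain m where m: "K \<subseteq> S m"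
          using exhG[OF K] by blast
        obtain C where C: "compactin T C" "\<And>k x. k \<in> K \<Longrightarrow> x \<in> X \<Longrightarrow> k \<otimes> x \<in> X \<union> C"
          by (rule commensuratedE[OF X(1) K], rule that)
        obtain D where D: "compactin T D" "X \<inter> H m \<subseteq> D"
          using thin[OF S[of m]] XG unfolding H_def by (elim rel_compactE) auto
        have "k \<otimes> x \<in> Y \<union> (C \<union> (K <#> D))" if k: "k \<in> K" and x: "x \<in> Y" for k x
        proof (cases "x \<in> H m")
          case True
          then have "x \<in> D"
            using x D(2) by (auto simp: Y_def)
          then show ?thesis
            using k by (auto simp: set_mult_def)
        next
          case False
          moreover have "k \<in> H m"
            using k m S_H by blast
          moreover have "x \<in> X" "x \<in> carrier G"
            using x XG by (auto simp: Y_def)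
          ultimately show ?thesis
            using level_step[of k m x] C(2)[OF k, of x] x by (auto simp: Y_def)
        qed
        moreover have "compactin T (C \<union> (K <#> D))"
          using C(1) D(1) K compactin_Un compactin_set_mult by blast
        ultimately show "\<exists>C. compactin T C \<and> (\<forall>k\<in>K. \<forall>x\<in>Y. k \<otimes> x \<in> Y \<union> C)"
          by blast
      qed
      show "Y \<subseteq> X"
        by (auto simp: Y_def)
      show "\<not> rel_compact Y"
        unfolding Y_def
      proof (rule unbounded)
        show "\<exists>i\<ge>n. even (Suc i)" for n
          by (rule exI[of _ "2 * n + 1"]) simp
      qed
      have "X - Y = {x \<in> X. odd (level x)}"
        by (auto simp: Y_def)
      moreover have "\<not> rel_compact {x \<in> X. odd (level x)}"
      proof (rule unbounded)
        show "\<exists>i\<ge>n. odd (Suc i)" for n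
          by (rule exI[of _ "2 * n"]) simp
      qed
      ultimately show "\<not> rel_compact (X - Y)"
        by simp
    qed
  qed
qed

lemma commensurated_split:
  assumes X: "commensurated X" "\<not> rel_compact X"
    and U: "commensurated U" "\<not> rel_compact U" and V: "commensurated V" "\<not> rel_compact V"
    and disj: "X \<inter> U = {}" "X \<inter> V = {}" "U \<inter> V = {}"
  obtains Y where "commensurated Y" "Y \<subseteq> X" "\<not> rel_compact Y" "\<not> rel_compact (X - Y)"
proof (cases "\<exists>K. symmetric_nbhd K \<and> \<not> rel_compact (X \<inter> generate G K)")
  case True
  then obtain K where K: "symmetric_nbhd K" "\<not> rel_compact (X \<inter> generate G K)"
    by blast
  have mono: "\<not> rel_compact (A \<inter> generate G L')"
    if "\<not> rel_compact (A \<inter> generate G L)" "L \<subseteq> L'" for A L L'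
    using that rel_compact_subset[of "A \<inter> generate G L'" "A \<inter> generate G L"] mono_generate[of L L'] by blast
  have unb: "\<not> rel_compact (generate G L)" if "\<not> rel_compact (A \<inter> generate G L)" for A L
    using that rel_compact_subset by blast
  obtain L where L: "symmetric_nbhd L" "K \<subseteq> L" "\<not> rel_compact (U \<inter> generate G L)"
    using ex_generate_meets_unbounded[OF K(1) unb[OF K(2)] U] by blast
  obtain N where N: "symmetric_nbhd N" "L \<subseteq> N" "\<not> rel_compact (V \<inter> generate G N)"
    using ex_generate_meets_unbounded[OF L(1) unb[OF L(3)] V] by blast
  have "K \<subseteq> N"
    using L(2) N(2) by blast
  then show ?thesis
    by (rule split_compactly_generated[OF N(1) X(1) mono[OF K(2)] U(1) mono[OF L(3) N(2)] V(1) N(3) disj, OF _ that])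
next
  case False
  have "\<not> rel_compact (carrier G - X)"
    using U disj(1) rel_compact_subset[of "carrier G - X" U] commensurated_subset_carrier by blast
  then show ?thesis
    using split_without_compactly_generated[OF X] False that by blast
qed

end

section \<open>Isolated points of Stone spaces\<close>

text \<open>
  An ultrafilter is downward directed, so the subbasic sets that contain it already form a
  neighbourhood basis.
\<close>
lemma stone_space_basic_nbhd:
  assumes p: "p \<in> ultrafilters L" and W: "openin (stone_space L) W" "p \<in> W"
  obtains a where "a \<in> p" "{F \<in> ultrafilters L. a \<in> F} \<subseteq> W"
proof -
  have pf: "proper_filter L p"
    using p by (simp add: ultrafilters_def)
  have "generate_topology_on ((\<lambda>a. {F \<in> ultrafilters L. a \<in> F}) ` carrier L) W"
    using W(1) unfolding stone_space_def by (rule openin_topology_generated_by)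
  then have "p \<in> W \<longrightarrow> (\<exists>a\<in>p. {F \<in> ultrafilters L. a \<in> F} \<subseteq> W)"
  proof (induction rule: generate_topology_on.induct)
    case Empty
    show ?case by simp
  next
    case (Int W\<^sub>1 W\<^sub>2)
    show ?case
    proof
      assume "p \<in> W\<^sub>1 \<inter> W\<^sub>2"
      then obtain a b where a: "a \<in> p" "{F \<in> ultrafilters L. a \<in> F} \<subseteq> W\<^sub>1"
        and b: "b \<in> p" "{F \<in> ultrafilters L. b \<in> F} \<subseteq> W\<^sub>2"
        using Int.IH by blast
      obtain c where c: "c \<in> p" "c \<sqsubseteq>\<^bsub>L\<^esub> a" "c \<sqsubseteq>\<^bsub>L\<^esub> b"
        using pf a(1) b(1) unfolding proper_filter_def by blast
      have "a \<in> carrier L" "b \<in> carrier L"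
        using pf a(1) b(1) unfolding proper_filter_def by blast+
      then have "a \<in> F \<and> b \<in> F" if F: "F \<in> ultrafilters L" "c \<in> F" for F
        using F c(2,3) unfolding ultrafilters_def proper_filter_def by blast
      then have "{F \<in> ultrafilters L. c \<in> F} \<subseteq> W\<^sub>1 \<inter> W\<^sub>2"
        using a(2) b(2) by blast
      then show "\<exists>a\<in>p. {F \<in> ultrafilters L. a \<in> F} \<subseteq> W\<^sub>1 \<inter> W\<^sub>2"
        using c(1) by blast
    qed
  next
    case (UN \<U>)
    then show ?case by blast
  next
    case (Basis s)
    then show ?case by blast
  qed
  then show ?thesis
    using W(2) that by blast
qed

lemma bottom_notin_proper_filter:
  assumes "proper_filter L F" "\<And>b. b \<in> carrier L \<Longrightarrow> z \<sqsubseteq>\<^bsub>L\<^esub> b"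
  shows "z \<notin> F"
  using assms unfolding proper_filter_def by blast

text \<open>
  Zorn's lemma applied to the proper filters containing \<open>a\<close>. Upward closure makes properness
  equivalent to omitting the bottom element \<open>z\<close>, a condition inherited by unions of chains.
\<close>
lemma ex_ultrafilter_containing:
  assumes refl: "\<And>b. b \<in> carrier L \<Longrightarrow> b \<sqsubseteq>\<^bsub>L\<^esub> b"
    and trans: "\<And>b c d. b \<in> carrier L \<Longrightarrow> c \<in> carrier L \<Longrightarrow> d \<in> carrier L \<Longrightarrow>
      b \<sqsubseteq>\<^bsub>L\<^esub> c \<Longrightarrow> c \<sqsubseteq>\<^bsub>L\<^esub> d \<Longrightarrow> b \<sqsubseteq>\<^bsub>L\<^esub> d"
    and z: "z \<in> carrier L" "\<And>b. b \<in> carrier L \<Longrightarrow> z \<sqsubseteq>\<^bsub>L\<^esub> b"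
    and a: "a \<in> carrier L" "\<not> a \<sqsubseteq>\<^bsub>L\<^esub> z"
  obtains F where "F \<in> ultrafilters L" "a \<in> F"
proof -
  define \<A> where "\<A> = {F. proper_filter L F \<and> a \<in> F}"
  have "{b \<in> carrier L. a \<sqsubseteq>\<^bsub>L\<^esub> b} \<in> \<A>"
    unfolding \<A>_def proper_filter_def using a refl[OF a(1)] z(1) trans by blast
  moreover have "\<Union>\<C> \<in> \<A>" if ne: "\<C> \<noteq> {}" and chain: "subset.chain \<A> \<C>" for \<C>
  proof -
    have pf: "proper_filter L F" "a \<in> F" if "F \<in> \<C>" for F
      using chain that unfolding subset.chain_def \<A>_def by blast+
    have "z \<notin> \<Union>\<C>"
      using bottom_notin_proper_filter[OF pf(1) z(2)] by blast
    then have "\<Union>\<C> \<noteq> carrier L"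
      using z(1) by blast
    moreover have "\<exists>c\<in>\<Union>\<C>. c \<sqsubseteq>\<^bsub>L\<^esub> x \<and> c \<sqsubseteq>\<^bsub>L\<^esub> y" if xy: "x \<in> \<Union>\<C>" "y \<in> \<Union>\<C>" for x y
    proof -
      obtain E F where EF: "E \<in> \<C>" "x \<in> E" "F \<in> \<C>" "y \<in> F"
        using xy by blast
      then have "E \<subseteq> F \<or> F \<subseteq> E"
        using chain unfolding subset.chain_def by blast
      then obtain D where "D \<in> \<C>" "x \<in> D" "y \<in> D"
        using EF by blast
      then show ?thesis
        using pf(1)[of D] unfolding proper_filter_def by blast
    qed
    moreover have "\<Union>\<C> \<subseteq> carrier L"
      using pf(1) unfolding proper_filter_def by blast
    moreover have "\<forall>x\<in>\<Union>\<C>. \<forall>y\<in>carrier L. x \<sqsubseteq>\<^bsub>L\<^esub> y \<longrightarrow> y \<in> \<Union>\<C>"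
      using pf(1) unfolding proper_filter_def by blast
    moreover have "a \<in> \<Union>\<C>"
      using ne pf(2) by blast
    ultimately show ?thesis
      unfolding \<A>_def proper_filter_def by blast
  qed
  ultimately obtain F where F: "F \<in> \<A>" "\<forall>F'\<in>\<A>. F \<subseteq> F' \<longrightarrow> F' = F"
    using subset_Zorn_nonempty[of \<A>] by blast
  then have "F \<in> ultrafilters L" "a \<in> F"
    unfolding ultrafilters_def \<A>_def by blast+
  then show ?thesis
    by (rule that)
qed

section \<open>The algebra of ends\<close>

context lc_group
begin

abbreviation end_class :: "'a set \<Rightarrow> 'a set set" where
  "end_class X \<equiv> ends_rel G T `` {X}"

lemma carrier_ends_algebra: "carrier (ends_algebra G T) = end_class ` left_commensurated G T"
  unfolding ends_algebra_def quotient_def by auto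

lemma equiv_ends_rel: "equiv (left_commensurated G T) (ends_rel G T)"
proof (rule equivI)
  show "ends_rel G T \<subseteq> left_commensurated G T \<times> left_commensurated G T"
    by (auto simp: ends_rel_def)
  show "refl_on (left_commensurated G T) (ends_rel G T)"
    by (auto simp: refl_on_def ends_rel_def rel_compact_empty)
  show "sym (ends_rel G T)"
    by (auto simp: sym_def ends_rel_def Un_commute)
  show "trans (ends_rel G T)"
  proof (rule transI)
    fix X Y Z assume "(X, Y) \<in> ends_rel G T" "(Y, Z) \<in> ends_rel G T"
    then have *: "commensurated X" "commensurated Z"
      "rel_compact ((X - Y) \<union> (Y - X))" "rel_compact ((Y - Z) \<union> (Z - Y))"
      by (auto simp: ends_rel_def)
    have "rel_compact ((X - Z) \<union> (Z - X))"
      by (rule rel_compact_subset[OF rel_compact_Un[OF *(3,4)]]) blast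
    then show "(X, Z) \<in> ends_rel G T"
      using * by (simp add: ends_rel_def)
  qed
qed

lemma end_class_eqI:
  assumes "commensurated X" "commensurated Y" "rel_compact (X - Y)" "rel_compact (Y - X)"
  shows "end_class X = end_class Y"
proof -
  have "(X, Y) \<in> ends_rel G T"
    using assms rel_compact_Un by (auto simp: ends_rel_def)
  then show ?thesis
    by (rule equiv_class_eq[OF equiv_ends_rel])
qed

lemma end_class_le_iff:
  assumes "commensurated X" "commensurated Y"
  shows "end_class X \<sqsubseteq>\<^bsub>ends_algebra G T\<^esub> end_class Y \<longleftrightarrow> rel_compact (X - Y)"
proof
  assume "rel_compact (X - Y)"
  then show "end_class X \<sqsubseteq>\<^bsub>ends_algebra G T\<^esub> end_class Y"
    using equiv_class_self[OF equiv_ends_rel assms(1)] equiv_class_self[OF equiv_ends_rel assms(2)]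
    unfolding ends_algebra_def by auto
next
  assume "end_class X \<sqsubseteq>\<^bsub>ends_algebra G T\<^esub> end_class Y"
  then obtain X' Y' where *: "(X, X') \<in> ends_rel G T" "(Y, Y') \<in> ends_rel G T" "rel_compact (X' - Y')"
    unfolding ends_algebra_def by auto
  then have "rel_compact ((X - X') \<union> (X' - X))" "rel_compact ((Y - Y') \<union> (Y' - Y))"
    by (auto simp: ends_rel_def)
  then have "rel_compact (((X - X') \<union> (X' - X)) \<union> ((Y - Y') \<union> (Y' - Y)) \<union> (X' - Y'))"
    using *(3) rel_compact_Un by blast
  then show "rel_compact (X - Y)"
    by (rule rel_compact_subset) blast
qed

lemma ex_end_containing:
  assumes "commensurated Y" "\<not> rel_compact Y"
  obtains F where "F \<in> ultrafilters (ends_algebra G T)" "end_class Y \<in> F"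
proof (rule ex_ultrafilter_containing[of "ends_algebra G T" "end_class {}" "end_class Y"])
  let ?L = "ends_algebra G T"
  show "b \<sqsubseteq>\<^bsub>?L\<^esub> b" if "b \<in> carrier ?L" for b
    using that by (auto simp: carrier_ends_algebra end_class_le_iff rel_compact_empty)
  show "b \<sqsubseteq>\<^bsub>?L\<^esub> d"
    if bcd: "b \<in> carrier ?L" "c \<in> carrier ?L" "d \<in> carrier ?L" "b \<sqsubseteq>\<^bsub>?L\<^esub> c" "c \<sqsubseteq>\<^bsub>?L\<^esub> d" for b c d
  proof -
    obtain B C D where BCD: "commensurated B" "b = end_class B" "commensurated C" "c = end_class C"
      "commensurated D" "d = end_class D"
      using bcd(1-3) unfolding carrier_ends_algebra by blast
    then have "rel_compact (B - C)" "rel_compact (C - D)"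
      using bcd(4,5) end_class_le_iff by auto
    then have "rel_compact (B - D)"
      using rel_compact_subset[OF rel_compact_Un, of "B - C" "C - D" "B - D"] by blast
    then show ?thesis
      using BCD end_class_le_iff by simp
  qed
  show "end_class {} \<in> carrier ?L"
    unfolding carrier_ends_algebra using commensurated_empty by blast
  show "end_class {} \<sqsubseteq>\<^bsub>?L\<^esub> b" if "b \<in> carrier ?L" for b
    using that by (auto simp: carrier_ends_algebra end_class_le_iff commensurated_empty rel_compact_empty)
  show "end_class Y \<in> carrier ?L"
    unfolding carrier_ends_algebra using assms(1) by blast
  show "\<not> end_class Y \<sqsubseteq>\<^bsub>?L\<^esub> end_class {}"
    using assms by (simp add: end_class_le_iff commensurated_empty)
qed (rule that)

lemma end_class_notin_proper_filter:
  assumes p: "proper_filter (ends_algebra G T) p" and X: "commensurated X" "rel_compact X"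
  shows "end_class X \<notin> p"
proof (rule bottom_notin_proper_filter[OF p])
  fix b assume "b \<in> carrier (ends_algebra G T)"
  then show "end_class X \<sqsubseteq>\<^bsub>ends_algebra G T\<^esub> b"
    using X rel_compact_subset[OF X(2)] by (auto simp: carrier_ends_algebra end_class_le_iff)
qed

text \<open>
  Some class \<open>a\<close> belongs to the ultrafilter \<open>p\<close> and to no other one. Let \<open>X\<close> represent \<open>a\<close>. Were \<open>X\<close>
  the disjoint union of two unbounded commensurated sets, ultrafilters through either part would contain
  \<open>a\<close> and hence be \<open>p\<close>, so that \<open>p\<close> would contain two disjoint elements.
\<close>
lemma isolated_end_imp_atom:
  assumes p: "p \<in> ultrafilters (ends_algebra G T)" and iso: "openin (ends_space G T) {p}"
  obtains X where "commensurated X" "\<not> rel_compact X"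
    "\<And>Y. commensurated Y \<Longrightarrow> Y \<subseteq> X \<Longrightarrow> rel_compact Y \<or> rel_compact (X - Y)"
proof -
  let ?L = "ends_algebra G T"
  have pf: "proper_filter ?L p"
    using p by (simp add: ultrafilters_def)
  obtain a where a: "a \<in> p" "{F \<in> ultrafilters ?L. a \<in> F} \<subseteq> {p}"
    using iso unfolding ends_space_def by (rule stone_space_basic_nbhd[OF p]) simp
  have "p \<subseteq> carrier ?L"
    using pf unfolding proper_filter_def by blast
  then obtain X where X: "commensurated X" "a = end_class X"
    using a(1) unfolding carrier_ends_algebra by blast
  have in_p: "end_class Y \<in> p" if Y: "commensurated Y" "Y \<subseteq> X" "\<not> rel_compact Y" for Y
  proof -
    obtain F where F: "F \<in> ultrafilters ?L" "end_class Y \<in> F"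
      by (rule ex_end_containing[OF Y(1,3)])
    have "end_class Y \<sqsubseteq>\<^bsub>?L\<^esub> end_class X"
      using Y X(1) by (simp add: end_class_le_iff Diff_eq_empty_iff[THEN iffD2] rel_compact_empty)
    moreover have "end_class X \<in> carrier ?L"
      unfolding carrier_ends_algebra using X(1) by blast
    ultimately have "a \<in> F"
      using F X(2) unfolding ultrafilters_def proper_filter_def by blast
    then show ?thesis
      using a(2) F by blast
  qed
  show ?thesis
  proof
    show "commensurated X" by (rule X(1))
    show "\<not> rel_compact X"
      using end_class_notin_proper_filter[OF pf X(1)] a(1) X(2) by blast
    fix Y assume Y: "commensurated Y" "Y \<subseteq> X"
    show "rel_compact Y \<or> rel_compact (X - Y)"
    proof (rule ccontr)
      assume unb: "\<not> (rel_compact Y \<or> rel_compact (X - Y))"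
      have cD: "commensurated (X - Y)"
        by (rule commensurated_Diff[OF X(1) Y(1)])
      have "end_class Y \<in> p" "end_class (X - Y) \<in> p"
        using in_p[OF Y] in_p[OF cD] unb by auto
      then obtain c where c: "c \<in> p" "c \<sqsubseteq>\<^bsub>?L\<^esub> end_class Y" "c \<sqsubseteq>\<^bsub>?L\<^esub> end_class (X - Y)"
        using pf unfolding proper_filter_def by blast
      then obtain W where W: "commensurated W" "c = end_class W"
        using \<open>p \<subseteq> carrier ?L\<close> unfolding carrier_ends_algebra by blast
      have "rel_compact (W - Y)" "rel_compact (W - (X - Y))"
        using c(2,3) W Y(1) cD by (simp_all add: end_class_le_iff)
      then have "rel_compact ((W - Y) \<union> (W - (X - Y)))"
        by (rule rel_compact_Un)
      then have "rel_compact W"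
        by (rule rel_compact_subset) blast
      then show False
        using end_class_notin_proper_filter[OF pf W(1)] c(1) W(2) by blast
    qed
  qed
qed

text \<open>
  Modulo bounded sets, a commensurated set meets \<open>X\<close> and its complement each in nothing or
  in everything.
\<close>
lemma ends_algebra_finite_if_unsplittable:
  assumes X: "commensurated X"
    and atomX: "\<And>Y. commensurated Y \<Longrightarrow> Y \<subseteq> X \<Longrightarrow> rel_compact Y \<or> rel_compact (X - Y)"
    and atomC: "\<And>Y. commensurated Y \<Longrightarrow> Y \<subseteq> carrier G - X \<Longrightarrow>
      rel_compact Y \<or> rel_compact (carrier G - X - Y)"
  shows "finite (carrier (ends_algebra G T))"
proof (rule finite_subset)
  have cG: "commensurated (carrier G)"
    using commensurated_compl[OF commensurated_empty] by simp
  have XG: "X \<subseteq> carrier G"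
    by (rule commensurated_subset_carrier[OF X])
  show "carrier (ends_algebra G T) \<subseteq> end_class ` {{}, X, carrier G - X, carrier G}"
  proof
    fix b assume "b \<in> carrier (ends_algebra G T)"
    then obtain B where B: "commensurated B" "b = end_class B"
      unfolding carrier_ends_algebra by blast
    have BG: "B \<subseteq> carrier G"
      by (rule commensurated_subset_carrier[OF B(1)])
    have 1: "rel_compact (B \<inter> X) \<or> rel_compact (X - B)"
      using atomX[OF commensurated_Int[OF B(1) X]] by (simp add: Diff_Int)
    have 2: "rel_compact (B - X) \<or> rel_compact (carrier G - X - B)"
    proof -
      have "carrier G - X - (B - X) = carrier G - X - B"
        by blast
      then show ?thesis
        using atomC[OF commensurated_Diff[OF B(1) X]] BG by fastforce
    qed
    have eq: "b \<in> end_class ` {{}, X, carrier G - X, carrier G}"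
      if E: "E \<in> {{}, X, carrier G - X, carrier G}" and D: "rel_compact D" "rel_compact D'"
        and BE: "B - E \<subseteq> D \<union> D'" "E - B \<subseteq> D \<union> D'"
      for D D' E
    proof -
      have "commensurated E"
        using E X cG commensurated_empty commensurated_compl by blast
      then have "b = end_class E"
        unfolding B(2) using B(1) rel_compact_subset[OF rel_compact_Un[OF D]] BE by (intro end_class_eqI) auto
      then show ?thesis
        using E by blast
    qed
    from 1 2 show "b \<in> end_class ` {{}, X, carrier G - X, carrier G}"
    proof (elim disjE)
      assume "rel_compact (B \<inter> X)" "rel_compact (B - X)"
      then show ?thesis
        by (intro eq[of "{}" "B \<inter> X" "B - X"]) auto
    next
      assume "rel_compact (B \<inter> X)" "rel_compact (carrier G - X - B)"
      then show ?thesis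
        using BG by (intro eq[of "carrier G - X" "B \<inter> X" "carrier G - X - B"]) auto
    next
      assume "rel_compact (X - B)" "rel_compact (B - X)"
      then show ?thesis
        by (intro eq[of X "X - B" "B - X"]) auto
    next
      assume "rel_compact (X - B)" "rel_compact (carrier G - X - B)"
      then show ?thesis
        using BG by (intro eq[of "carrier G" "X - B" "carrier G - X - B"]) auto
    qed
  qed
qed simp

end

theorem theorem1p25:
  fixes G :: "('a, 'm) monoid_scheme" and T :: "'a topology"
  assumes "lc_group G T"
    and "infinitely_ended G T"
  shows "\<not> (\<exists>p \<in> topspace (ends_space G T). openin (ends_space G T) {p})"
proof
  interpret lc_group G T by (rule assms(1))
  assume "\<exists>p \<in> topspace (ends_space G T). openin (ends_space G T) {p}"
  then obtain p where p: "p \<in> topspace (ends_space G T)" "openin (ends_space G T) {p}"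
    by blast
  have "p \<in> ultrafilters (ends_algebra G T)"
    using p(1) unfolding ends_space_def stone_space_def topology_generated_by_topspace by blast
  then obtain X where X: "commensurated X" "\<not> rel_compact X"
    and atom: "\<And>Y. commensurated Y \<Longrightarrow> Y \<subseteq> X \<Longrightarrow> rel_compact Y \<or> rel_compact (X - Y)"
    using isolated_end_imp_atom[OF _ p(2)] by metis
  have "rel_compact U \<or> rel_compact (carrier G - X - U)"
    if U: "commensurated U" "U \<subseteq> carrier G - X" for U
  proof (rule ccontr)
    assume unb: "\<not> (rel_compact U \<or> rel_compact (carrier G - X - U))"
    have V: "commensurated (carrier G - X - U)"
      by (rule commensurated_Diff[OF commensurated_compl[OF X(1)] U(1)])
    obtain Y where "commensurated Y" "Y \<subseteq> X" "\<not> rel_compact Y" "\<not> rel_compact (X - Y)"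
      by (rule commensurated_split[OF X U(1) _ V]) (use unb U(2) in auto)
    then show False
      using atom by blast
  qed
  then have "finite (carrier (ends_algebra G T))"
    using ends_algebra_finite_if_unsplittable[OF X(1)] atom by blast
  then show False
    using assms(2) by (simp add: infinitely_ended_def)
qed
end
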